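(* For any $\epsilon>0$, no (deterministic online) algorithm can be $(1.\overline{44}-\epsilon)$-competitive (i.e. $(\frac{13}{9}-\epsilon)$-competitive) for open online TSP on the line under the LOCATIONS prediction model, even when the predictions are perfect (prediction error $\eta=0$), against an adaptive adversary that chooses release times after observing the algorithm's moves.
   Context: Online TSP on the line: an agent starts at the origin at time $0$ and moves on the real line with speed at most $1$. There is a set $Q=\{q_1,\dots,q_n\}$ of requests, each with a position (also denoted $q_i$) and a release time; the algorithm knows $n$ in advance. A request $q$ is served at time $t$ if the agent was at position $q$ at some time $t'$ with $rel(q)\le t'\le t$. In the open variant the makespan $|ALG|$ is the first time at which all requests are served. $|OPT|$ is the optimal offline makespan; $c$-competitive means $|ALG|\le c|OPT|$ on every instance. LOCATIONS prediction model: at time $0$ the algorithm receives predicted positions $p_1,\dots,p_n$ for $q_1,\dots,q_n$; the error is $\eta=\max_i|q_i-p_i|/(|L|+|R|)$ with $L=\min Q$, $R=\max Q$ (a request at the origin released at time $0$ is assumed present). *)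

theory Defs
  imports "HOL-Analysis.Analysis"
begin

datatype request = Request (pos: real) (rel: real)

text \<open>An instance is a list of requests; the list index is the label that links a request to
  its prediction.  The request at the origin released at time \<open>0\<close> is one of the list entries.\<close>

definition valid_instance :: "request list \<Rightarrow> bool" where
  "valid_instance Q \<longleftrightarrow>
     (\<forall>q\<in>set Q. 0 \<le> rel q) \<and> (\<exists>q\<in>set Q. pos q = 0 \<and> rel q = 0)"

definition trajectory :: "(real \<Rightarrow> real) \<Rightarrow> bool" where
  "trajectory x \<longleftrightarrow> x 0 = 0 \<and> 1-lipschitz_on {0..} x"

definition served_by :: "(real \<Rightarrow> real) \<Rightarrow> request \<Rightarrow> real \<Rightarrow> bool" where
  "served_by x q t \<longleftrightarrow> (\<exists>t'. rel q \<le> t' \<and> t' \<le> t \<and> x t' = pos q)"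

text \<open>The infimum is attained whenever the set is nonempty (trajectories are continuous), so this
  is the first time at which everything is served; it is \<open>\<infinity>\<close> if that never happens.\<close>

definition makespan :: "(real \<Rightarrow> real) \<Rightarrow> request list \<Rightarrow> ereal" where
  "makespan x Q = Inf {ereal t | t. 0 \<le> t \<and> (\<forall>q\<in>set Q. served_by x q t)}"

definition opt :: "request list \<Rightarrow> ereal" where
  "opt Q = (INF x\<in>{x. trajectory x}. makespan x Q)"

text \<open>The part of the instance that has been revealed by time \<open>t\<close>.\<close>

definition released :: "request list \<Rightarrow> real \<Rightarrow> (nat \<times> request) set" where
  "released Q t = {(i, Q ! i) | i. i < length Q \<and> rel (Q ! i) \<le> t}"

text \<open>A deterministic online algorithm in the LOCATIONS model is a map from predicted positions
  and an instance to a trajectory, where the motion up to time \<open>t\<close> depends only on the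
  predictions (whose number is the number of requests) and on the requests released by time
  \<open>t\<close>.  Since a deterministic algorithm's reaction to any adaptive choice of release times is
  determined, an adaptive adversary amounts to choosing the instance after the algorithm.\<close>

definition online_algorithm :: "(real list \<Rightarrow> request list \<Rightarrow> real \<Rightarrow> real) \<Rightarrow> bool" where
  "online_algorithm A \<longleftrightarrow>
     (\<forall>p Q. valid_instance Q \<and> length p = length Q \<longrightarrow> trajectory (A p Q)) \<and>
     (\<forall>p Q Q' t. valid_instance Q \<and> valid_instance Q' \<and>
        length p = length Q \<and> length p = length Q' \<and> 0 \<le> t \<and>
        released Q t = released Q' t \<longrightarrow> (\<forall>s\<in>{0..t}. A p Q s = A p Q' s))"

text \<open>Division is in \<^typ>\<open>ereal\<close>, so that in the degenerate case where all requests are at the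
  origin the error is \<open>0\<close> for correct predictions and \<open>\<infinity>\<close> for incorrect ones.\<close>

definition prediction_error :: "real list \<Rightarrow> request list \<Rightarrow> ereal" where
  "prediction_error p Q =
     ereal (Max ((\<lambda>i. \<bar>pos (Q ! i) - p ! i\<bar>) ` {..<length Q})) /
     ereal (\<bar>Min (pos ` set Q)\<bar> + \<bar>Max (pos ` set Q)\<bar>)"

definition competitive_at_error ::
    "real \<Rightarrow> ereal \<Rightarrow> (real list \<Rightarrow> request list \<Rightarrow> real \<Rightarrow> real) \<Rightarrow> bool" where
  "competitive_at_error c \<eta> A \<longleftrightarrow>
     (\<forall>p Q. valid_instance Q \<and> length p = length Q \<and> prediction_error p Q = \<eta> \<longrightarrow>
        makespan (A p Q) Q \<le> ereal c * opt Q)"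

lemma prediction_error_eq_0_iff:
  assumes "valid_instance Q" "length p = length Q"
  shows "prediction_error p Q = 0 \<longleftrightarrow> p = map pos Q"
proof -
  let ?E = "(\<lambda>i. \<bar>pos (Q ! i) - p ! i\<bar>) ` {..<length Q}"
  have ne: "Q \<noteq> []" using assms(1) by (auto simp: valid_instance_def)
  have le: "e \<le> Max ?E" if "e \<in> ?E" for e using that by (intro Max_ge) auto
  have mem: "Max ?E \<in> ?E" using ne by (intro Max_in) auto
  have "prediction_error p Q = 0 \<longleftrightarrow> Max ?E = 0"
    unfolding prediction_error_def by (simp add: divide_ereal_def ereal_inverse_eq_0)
  also have "\<dots> \<longleftrightarrow> (\<forall>i<length Q. p ! i = pos (Q ! i))"
    using le mem by force
  also have "\<dots> \<longleftrightarrow> p = map pos Q"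
    using assms(2) by (auto simp: list_eq_iff_nth_eq)
  finally show ?thesis .
qed

end

theory Submission
  imports Defs
begin

text \<open>Besides the request at the origin there are requests at \<open>\<plusminus>1\<close>, released at time \<open>1\<close>, and at
  \<open>\<plusminus>2/3\<close>. If the algorithm is at a position \<open>\<le> 0\<close> at time \<open>4/3\<close>, the adversary goes
  first to \<open>1\<close> and then straight to \<open>-1\<close>, finishing at time \<open>3\<close>, and releases \<open>\<plusminus>2/3\<close> exactly when
  it passes them, at times \<open>4/3\<close> and \<open>8/3\<close>. If the algorithm serves \<open>1\<close> after \<open>-2/3\<close>, it
  finishes no earlier than \<open>8/3 + 5/3\<close>; if it serves \<open>1\<close> before \<open>-1\<close>, no earlier than
  \<open>4/3 + 1 + 2\<close>; the remaining order \<open>-1, 1, -2/3\<close> is even slower. All three bounds are at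
  least \<open>13/3\<close>. The other case is symmetric.\<close>

lemma trajectory_dist:
  assumes "trajectory x" "0 \<le> s" "0 \<le> t"
  shows "\<bar>x s - x t\<bar> \<le> \<bar>s - t\<bar>"
  using assms lipschitz_onD[of 1 "{0..}" x s t] by (simp add: trajectory_def dist_real_def)

lemma trajectory_uminus: "trajectory x \<Longrightarrow> trajectory (\<lambda>t. - x t)"
  by (simp add: trajectory_def lipschitz_on_def dist_minus)

text \<open>Online-ness yields agreement only strictly before 4/3, where the two adversary instances
  start to differ; continuity extends it to 4/3 itself.\<close>

lemma trajectories_eq_at_limit:
  assumes "trajectory x" "trajectory y" "0 < t" and eq: "\<And>s. 0 \<le> s \<Longrightarrow> s < t \<Longrightarrow> x s = y s"
  shows "x t = y t"
proof (rule ccontr)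
  assume ne: "x t \<noteq> y t"
  \<comment> \<open>From \<open>s\<close> to \<open>t\<close> each path moves at most a quarter of
    the gap, so the gap would be at most half of itself.\<close>
  define s where "s = max 0 (t - \<bar>x t - y t\<bar> / 4)"
  have s: "0 \<le> s" "s < t" "t - s \<le> \<bar>x t - y t\<bar> / 4"
    using ne assms(3) by (simp_all add: s_def max_def)
  have "\<bar>x s - x t\<bar> \<le> t - s" "\<bar>y s - y t\<bar> \<le> t - s"
    using trajectory_dist[OF assms(1), of s t] trajectory_dist[OF assms(2), of s t] s by simp_all
  then have "\<bar>x t - y t\<bar> \<le> 2 * (t - s)"
    using eq[OF s(1,2)] by (simp add: abs_le_iff)
  with s(3) ne show False by simp
qed

lemma served_by_uminus:
  "served_by (\<lambda>t. - x t) (Request (- a) r) t \<longleftrightarrow> served_by x (Request a r) t"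
  by (simp add: served_by_def)

text \<open>Only the release times of 2/3 and -2/3 are left open, so the adversary's options share
  one list of positions.\<close>

definition adversary_instance :: "real \<Rightarrow> real \<Rightarrow> request list" where
  "adversary_instance a b =
     [Request 0 0, Request 1 1, Request (-1) 1, Request (2/3) a, Request (-2/3) b]"

lemma valid_adversary_instance:
  "0 \<le> a \<Longrightarrow> 0 \<le> b \<Longrightarrow> valid_instance (adversary_instance a b)"
  by (simp add: valid_instance_def adversary_instance_def)

lemma released_eq_set_enumerate:
  "released Q t = set (filter (\<lambda>(i, q). rel q \<le> t) (List.enumerate 0 Q))"
  by (auto simp: released_def in_set_enumerate_eq)

lemma released_adversary_instance:
  assumes "t < a" "t < b"
  shows "released (adversary_instance a b) t = released (adversary_instance b a) t"
  using assms by (simp add: released_eq_set_enumerate adversary_instance_def)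

lemma served_late:
  assumes x: "trajectory x" "x (4/3) \<le> 0"
    and "served_by x (Request 1 1) T" "served_by x (Request (-1) 1) T"
      "served_by x (Request (-2/3) (8/3)) T"
  shows "13/3 \<le> T"
proof -
  obtain u v w where u: "1 \<le> u" "u \<le> T" "x u = 1" and w: "1 \<le> w" "w \<le> T" "x w = -1"
    and v: "8/3 \<le> v" "v \<le> T" "x v = -2/3"
    using assms(3-5) by (auto simp: served_by_def)
  have uw: "2 \<le> \<bar>u - w\<bar>" and uv: "5/3 \<le> \<bar>u - v\<bar>"
    and u0: "1 - x (4/3) \<le> \<bar>u - 4/3\<bar>" and w0: "1 + x (4/3) \<le> \<bar>w - 4/3\<bar>"
    using trajectory_dist[OF x(1), of u w] trajectory_dist[OF x(1), of u v]
      trajectory_dist[OF x(1), of u "4/3"] trajectory_dist[OF x(1), of w "4/3"] u v w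
    by simp_all
  \<comment> \<open>A visit to 1 before time 4/3 would have to occur by time 1/3, contradicting the
    release at 1.\<close>
  have u': "7/3 - x (4/3) \<le> u" using u0 u(1) x(2) by (simp add: abs_if split: if_splits)
  consider "u + 2 \<le> w" | "v + 5/3 \<le> u" | "w + 2 \<le> u" "u + 5/3 \<le> v"
    using uw uv by (fastforce simp: abs_if split: if_splits)
  then show ?thesis
  proof cases
    case 3
    show ?thesis
    proof (cases "w \<le> 4/3")
      \<comment> \<open>Serving -1 this early forces \<open>x (4/3)\<close> \<le> -2/3, hence
        \<open>u\<close> \<ge> 3 and \<open>v\<close> \<ge> 14/3.\<close>
      case True
      then show ?thesis using w0 w(1) u' v(2) 3 by simp
    next
      \<comment> \<open>Now \<open>w\<close> \<ge> 7/3 + \<open>x (4/3)\<close>, so \<open>u\<close>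
        \<ge> 13/3 + \<open>x (4/3)\<close>. Averaging with \<open>u'\<close> gives \<open>u\<close>
        \<ge> 10/3 and \<open>v\<close> \<ge> 5.\<close>
      case False
      then show ?thesis using w0 u' v(2) 3 by simp
    qed
  qed (use u u' v w x(2) in linarith)+
qed

lemma makespan_ge:
  assumes "\<And>t. (\<And>q. q \<in> set Q \<Longrightarrow> served_by x q t) \<Longrightarrow> c \<le> t"
  shows "ereal c \<le> makespan x Q"
  unfolding makespan_def using assms by (auto intro!: Inf_greatest)

lemma makespan_adversary_instance:
  assumes "trajectory x" "x (4/3) \<le> 0"
  shows "ereal (13/3) \<le> makespan x (adversary_instance (4/3) (8/3))"
  by (intro makespan_ge served_late[OF assms]) (auto simp: adversary_instance_def)

lemma makespan_adversary_instance':
  assumes "trajectory x" "0 \<le> x (4/3)"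
  shows "ereal (13/3) \<le> makespan x (adversary_instance (8/3) (4/3))"
proof (intro makespan_ge)
  fix t assume *: "\<And>q. q \<in> set (adversary_instance (8/3) (4/3)) \<Longrightarrow> served_by x q t"
  show "13/3 \<le> t"
    using assms *[of "Request 1 1"] *[of "Request (-1) 1"] *[of "Request (2/3) (8/3)"]
      served_by_uminus[of x 1 1 t] served_by_uminus[of x "-1" 1 t]
      served_by_uminus[of x "2/3" "8/3" t]
    by (intro served_late[of "\<lambda>t. - x t"] trajectory_uminus) (auto simp: adversary_instance_def)
qed

text \<open>The offline tour: it turns at 1 at time 1 and stops at -1 at time 3.\<close>

definition sweep :: "real \<Rightarrow> real" where
  "sweep t = max (-1) (min t (2 - t))"

lemma trajectory_sweep: "trajectory sweep"
proof -
  have "\<bar>sweep s - sweep t\<bar> \<le> \<bar>s - t\<bar>" for s t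
    unfolding sweep_def by (smt (verit))
  moreover have "sweep 0 = 0"
    by (simp add: sweep_def)
  ultimately show ?thesis
    by (simp add: trajectory_def lipschitz_on_def dist_real_def)
qed

lemma opt_le:
  assumes "trajectory x" "0 \<le> t" "\<And>q. q \<in> set Q \<Longrightarrow> served_by x q t"
  shows "opt Q \<le> ereal t"
proof -
  have "opt Q \<le> makespan x Q"
    unfolding opt_def using assms(1) by (intro INF_lower) simp
  also have "\<dots> \<le> ereal t"
    unfolding makespan_def using assms(2,3) by (intro Inf_lower) auto
  finally show ?thesis .
qed

lemma opt_nonneg: "0 \<le> opt Q"
  unfolding opt_def makespan_def by (intro INF_greatest Inf_greatest) auto

lemma sweep_serves:
  assumes "q \<in> set (adversary_instance (4/3) (8/3))"
  shows "served_by sweep q 3"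
proof -
  have "served_by sweep (Request 0 0) 3" "served_by sweep (Request 1 1) 3"
    "served_by sweep (Request (-1) 1) 3" "served_by sweep (Request (2/3) (4/3)) 3"
    "served_by sweep (Request (-2/3) (8/3)) 3"
    unfolding served_by_def
    \<comment> \<open>The witnesses are the times at which \<open>sweep\<close> visits 0, 1, -1, 2/3
      and -2/3.\<close>
    by (rule exI[of _ 0] exI[of _ 1] exI[of _ 3] exI[of _ "4/3"] exI[of _ "8/3"],
        simp add: sweep_def)+
  then show ?thesis using assms by (auto simp: adversary_instance_def)
qed

lemma opt_adversary_instance: "opt (adversary_instance (4/3) (8/3)) \<le> 3"
  using opt_le[OF trajectory_sweep _ sweep_serves] by simp

lemma opt_adversary_instance': "opt (adversary_instance (8/3) (4/3)) \<le> 3"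
proof -
  have "served_by (\<lambda>t. - sweep t) q 3" if "q \<in> set (adversary_instance (8/3) (4/3))" for q
  proof -
    obtain a r where q: "q = Request a r" by (cases q)
    have "Request (- a) r \<in> set (adversary_instance (4/3) (8/3))"
      using that q by (auto simp: adversary_instance_def)
    from sweep_serves[OF this] show ?thesis
      using served_by_uminus[of sweep "- a" r 3] q by simp
  qed
  from opt_le[OF trajectory_uminus[OF trajectory_sweep] _ this] show ?thesis by simp
qed

lemma competitive_at_errorD:
  assumes "competitive_at_error c 0 A" "valid_instance Q"
    and "ereal m \<le> makespan (A (map pos Q) Q) Q" "opt Q \<le> ereal d" "0 < m"
  shows "m \<le> c * d"
proof -
  have "ereal m \<le> ereal c * opt Q"
    using assms(1-3) prediction_error_eq_0_iff[of Q "map pos Q"]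
    by (force simp: competitive_at_error_def)
  moreover obtain r where r: "opt Q = ereal r" "0 \<le> r" "r \<le> d"
    using assms(4) opt_nonneg[of Q] by (cases "opt Q") auto
  ultimately have "m \<le> c * r" by simp
  \<comment> \<open>For large \<epsilon> the ratio could be negative; its sign is needed to replace
    the optimum by the upper bound \<open>d\<close>.\<close>
  moreover from this have "0 < c"
    using r(2) assms(5) by (smt (verit) mult_nonpos_nonneg)
  ultimately show ?thesis
    using r(3) by (smt (verit) mult_left_mono)
qed

theorem theorem4:
  fixes \<epsilon> :: real
  assumes "\<epsilon> > 0"
  shows "\<not> (\<exists>A. online_algorithm A \<and> competitive_at_error (13 / 9 - \<epsilon>) 0 A)"
proof
  assume "\<exists>A. online_algorithm A \<and> competitive_at_error (13 / 9 - \<epsilon>) 0 A"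
  then obtain A where A: "online_algorithm A" and comp: "competitive_at_error (13 / 9 - \<epsilon>) 0 A"
    by blast
  define Q where "Q = adversary_instance (4/3) (8/3)"
  define Q' where "Q' = adversary_instance (8/3) (4/3)"
  define p where "p = map pos Q"
  \<comment> \<open>The same predictions are perfect for both instances, so they do not reveal which
    one is played.\<close>
  have p': "p = map pos Q'"
    by (simp add: p_def Q_def Q'_def adversary_instance_def)
  have len: "length p = length Q" "length p = length Q'"
    by (simp add: p_def) (simp add: p')
  have valid: "valid_instance Q" "valid_instance Q'"
    by (simp_all add: Q_def Q'_def valid_adversary_instance)
  have traj: "trajectory (A p Q)" "trajectory (A p Q')"
    using A valid len by (auto simp: online_algorithm_def)
  have "A p Q s = A p Q' s" if "0 \<le> s" "s < 4/3" for s
  proof -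
    have "released Q s = released Q' s"
      unfolding Q_def Q'_def using that by (intro released_adversary_instance) auto
    then show ?thesis
      using A valid len that unfolding online_algorithm_def
      by (meson atLeastAtMost_iff order_refl)
  qed
  then have eq: "A p Q (4/3) = A p Q' (4/3)"
    by (rule trajectories_eq_at_limit[OF traj, rotated]) auto
  have "13/3 \<le> (13 / 9 - \<epsilon>) * 3"
  proof (cases "A p Q (4/3) \<le> 0")
    case True
    then have "ereal (13/3) \<le> makespan (A p Q) Q"
      using traj(1) makespan_adversary_instance by (simp add: Q_def)
    then show ?thesis
      using competitive_at_errorD[OF comp valid(1), of "13/3" 3] opt_adversary_instance
      by (simp add: p_def Q_def)
  next
    case False
    then have "ereal (13/3) \<le> makespan (A p Q') Q'"
      using traj(2) eq makespan_adversary_instance' by (simp add: Q'_def)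
    then show ?thesis
      using competitive_at_errorD[OF comp valid(2), of "13/3" 3] opt_adversary_instance'
      by (simp add: p' Q'_def)
  qed
  with assms show False by simp
qed

end
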